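(* Let $k,\ell$ be odd integers with $\gcd(k,\ell)=1$ and $k<\ell<\sqrt3 k$. Then there exist positive integers $d_1,d_2$ such that $d=d_1d_2$ is squarefree, $d\equiv 3\pmod 4$, $d_1<d_2\le 3d_1$ and $k^2d_2-\ell^2d_1=\pm 2$. Moreover, if $(d_1',d_2',k,\ell)$ is any tuple of integers with $d_1',d_2'>0$, $d_1'd_2'$ squarefree, $d_1'd_2'\equiv 3\pmod 4$, $d_1'<d_2'\le 3d_1'$ and $k^2d_2'-\ell^2d_1'=\pm2$, then for infinitely many integers $n$ the tuple $(d_1'+2k^2n,\ d_2'+2\ell^2n,\ k,\ \ell)$ satisfies the same conditions, i.e. $d_1''=d_1'+2k^2n$, $d_2''=d_2'+2\ell^2n$ are positive, $d_1''d_2''$ is squarefree and $\equiv 3\pmod 4$, $d_1''<d_2''\le 3d_1''$, and $k^2d_2''-\ell^2d_1''=\pm2$. *)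

theory Defs
  imports Complex_Main "HOL-Computational_Algebra.Squarefree" "HOL-Number_Theory.Cong"
begin

definition admissible :: "int \<Rightarrow> int \<Rightarrow> int \<Rightarrow> int \<Rightarrow> bool" where
  "admissible d1 d2 k l \<longleftrightarrow>
     d1 > 0 \<and> d2 > 0 \<and>
     squarefree (d1 * d2) \<and> [d1 * d2 = 3] (mod 4) \<and>
     d1 < d2 \<and> d2 \<le> 3 * d1 \<and>
     (k^2 * d2 - l^2 * d1 = 2 \<or> k^2 * d2 - l^2 * d1 = - 2)"

end

(*
  The solutions of k^2 d2 - l^2 d1 = 2 with d1, d2 odd lie in progressions
  (d1 + 2 k^2 n, d2 + 2 l^2 n); oddness of k, l makes d1 d2 = 3 (mod 4) automatic, and the ratio
  d2 / d1 tends to l^2 / k^2, which lies strictly between 1 and 3.  Both entries are coprime to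
  their moduli and to each other, so only squarefreeness needs a sieve.  A linear form coprime to
  its even modulus can only be divisible by p^2 for odd p, in at most one residue class mod p^2,
  and the sum of 1/q^2 over odd q >= 3 is at most 1/4; hence the two forms together lose about
  half of all n at most.
*)
theory Submission
  imports Defs
begin

text \<open>Since \<open>A\<close> is invertible modulo \<open>q\<close>, the solutions
  \<open>n\<close> fill at most one residue class. So each block of \<open>q\<close> consecutive
  numbers, indexed by \<open>n div q\<close>, contains at most one of them.\<close>

lemma card_dvd_linear_le:
  fixes a A :: int
  assumes "q > 0" and "coprime A (int q)"
  shows "card {n \<in> {..<N}. int q dvd a + A * int n} \<le> N div q + 1"
proof -
  let ?S = "{n \<in> {..<N}. int q dvd a + A * int n}"
  have "inj_on (\<lambda>n. n div q) ?S"
  proof (rule inj_onI)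
    fix m n assume m: "m \<in> ?S" and n: "n \<in> ?S" and eq: "m div q = n div q"
    have "int q dvd (a + A * int m) - (a + A * int n)"
      using m n by (intro dvd_diff) auto
    then have "int q dvd A * (int m - int n)"
      by (simp add: algebra_simps)
    then have "int q dvd int m - int n"
      using assms(2) by (simp add: coprime_commute coprime_dvd_mult_right_iff)
    then have "int m mod int q = int n mod int q"
      by (simp add: mod_eq_dvd_iff)
    then have "m mod q = n mod q"
      by (metis of_nat_eq_iff zmod_int)
    with eq show "m = n"
      by (metis div_mult_mod_eq)
  qed
  then have "card ?S = card ((\<lambda>n. n div q) ` ?S)"
    by (simp add: card_image)
  also have "\<dots> \<le> card {..N div q}"
    by (intro card_mono) (auto intro: div_le_mono)
  finally show ?thesis by simp
qed

text \<open>Telescoping: \<open>(2 * j + 1)^2\<close> exceeds \<open>4 * j * (j + 1)\<close> by one.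
  The subtracted tail is what makes the induction close.\<close>

lemma sum_inverse_odd_squares_le:
  "(\<Sum>j=1..M. 1 / real ((2 * j + 1)\<^sup>2)) \<le> 1/4 - 1 / (4 * real (M + 1))"
proof (induction M)
  case 0
  then show ?case by simp
next
  case (Suc M)
  have "1 / real ((2 * Suc M + 1)\<^sup>2) \<le> 1 / (4 * real (M + 1) * real (M + 2))"
  proof (rule divide_left_mono)
    show "4 * real (M + 1) * real (M + 2) \<le> real ((2 * Suc M + 1)\<^sup>2)"
      by (simp add: power2_eq_square algebra_simps)
  qed (simp_all add: zero_less_mult_iff)
  also have "\<dots> = 1 / (4 * real (M + 1)) - 1 / (4 * real (Suc M + 1))"
    by (simp add: divide_simps)
  finally show ?case using Suc by simp
qed

text \<open>A prime whose square divides the value is coprime to the even \<open>A\<close>, hence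
  odd, say \<open>2 * j + 1\<close>. Values at \<open>n < 8 * M\<close> are too small for
  \<open>j > M\<close>.\<close>

lemma not_squarefree_linearE:
  fixes a A :: int
  assumes "a > 0" "A > 0" "even A" "coprime a A"
    and "int M \<ge> 2 * A + a" and "n < 8 * M" and "\<not> squarefree (a + A * int n)"
  obtains j where "j \<in> {1..M}" "coprime A (int ((2 * j + 1)\<^sup>2))"
    "int ((2 * j + 1)\<^sup>2) dvd a + A * int n"
proof -
  let ?x = "a + A * int n"
  have xpos: "?x > 0" using assms by (simp add: add_pos_nonneg)
  obtain p where p: "prime p" "p\<^sup>2 dvd ?x"
    using assms(7) xpos by (auto simp: squarefree_factorial_semiring)
  have "coprime ?x A"
    using assms(4) by (metis coprime_iff_gcd_eq_1 gcd.commute gcd_add_mult mult.commute add.commute)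
  moreover have "p dvd ?x"
    using p(2) by (meson dvd_trans dvd_power zero_less_numeral)
  ultimately have cop: "coprime A p"
    by (metis coprime_commute coprime_divisors dvd_refl)
  have "odd p"
    using cop \<open>even A\<close> by (metis coprime_common_divisor odd_one dvd_refl)
  moreover have "p > 1" using p(1) by (simp add: prime_gt_1_int)
  ultimately obtain i where i: "p = 2 * i + 1" "i \<ge> 1"
    by (auto elim!: oddE)
  define j where "j = nat i"
  have pj: "p = int (2 * j + 1)" "j \<ge> 1"
    using i by (auto simp: j_def)
  have "j \<le> M"
  proof (rule ccontr)
    assume "\<not> j \<le> M"
    then have "2 * int M \<le> p" using pj by simp
    then have "(2 * int M)\<^sup>2 \<le> p\<^sup>2" by (intro power_mono) auto
    also have "\<dots> \<le> ?x" using p(2) xpos by (rule zdvd_imp_le)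
    also have "\<dots> < a + A * (8 * int M)"
      using assms(2,6) by simp
    finally have "4 * (int M * int M) < a + 8 * (A * int M)"
      by (simp add: power2_eq_square algebra_simps)
    \<comment> \<open>Four times this bound gives \<open>4 * M^2\<close> at least
      \<open>8 * A * M + 4 * a * M\<close>, hence at least \<open>8 * A * M + 4 * a\<close>, against
      the upper bound just found.\<close>
    moreover have "(2 * A + a) * int M \<le> int M * int M"
      using assms(5) by (intro mult_right_mono) auto
    moreover have "a * 1 \<le> a * int M"
      using assms(1,2,5) by (intro mult_left_mono) auto
    ultimately show False
      using \<open>a > 0\<close> by (simp add: algebra_simps)
  qed
  moreover have "int ((2 * j + 1)\<^sup>2) = p\<^sup>2" by (simp add: pj)
  ultimately show ?thesis
    using that[of j] pj cop p(2) by simp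
qed

text \<open>The quotients sum to at most \<open>8 * M / 4 = 2 * M\<close>, and the
  \<open>+ 1\<close> from each of at most \<open>M\<close> moduli adds another \<open>M\<close>. Two
  forms together thus lose at most \<open>6 * M\<close> of the \<open>8 * M\<close>
  candidates.\<close>

lemma card_not_squarefree_linear_le:
  fixes a A :: int
  assumes "a > 0" "A > 0" "even A" "coprime a A" and "int M \<ge> 2 * A + a"
  shows "card {n \<in> {..<8 * M}. \<not> squarefree (a + A * int n)} \<le> 3 * M"
proof -
  define J where "J = {j \<in> {1..M}. coprime A (int ((2 * j + 1)\<^sup>2))}"
  define S where "S j = {n \<in> {..<8 * M}. int ((2 * j + 1)\<^sup>2) dvd a + A * int n}" for j :: nat
  have fin: "finite J" "finite (S j)" for j by (auto simp: J_def S_def)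
  have "{n \<in> {..<8 * M}. \<not> squarefree (a + A * int n)} \<subseteq> (\<Union>j\<in>J. S j)"
  proof safe
    fix n assume "n < 8 * M" "\<not> squarefree (a + A * int n)"
    then obtain j where "j \<in> {1..M}" "coprime A (int ((2 * j + 1)\<^sup>2))"
      "int ((2 * j + 1)\<^sup>2) dvd a + A * int n"
      by (rule not_squarefree_linearE[OF assms])
    with \<open>n < 8 * M\<close> show "n \<in> (\<Union>j\<in>J. S j)"
      unfolding J_def S_def by blast
  qed
  then have "card {n \<in> {..<8 * M}. \<not> squarefree (a + A * int n)} \<le> card (\<Union>j\<in>J. S j)"
    using fin by (intro card_mono) auto
  also have "\<dots> \<le> (\<Sum>j\<in>J. card (S j))"
    using fin by (intro card_UN_le)
  also have "\<dots> \<le> (\<Sum>j\<in>J. (8 * M) div (2 * j + 1)\<^sup>2 + 1)"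
    unfolding S_def J_def by (intro sum_mono card_dvd_linear_le) auto
  \<comment> \<open>Coprimality of the modulus to \<open>A\<close> has served its purpose in the
    count; the sum may now run over all \<open>j\<close>.\<close>
  also have "\<dots> \<le> (\<Sum>j=1..M. (8 * M) div (2 * j + 1)\<^sup>2 + 1)"
    by (intro sum_mono2) (auto simp: J_def)
  finally have "real (card {n \<in> {..<8 * M}. \<not> squarefree (a + A * int n)})
      \<le> real (\<Sum>j=1..M. (8 * M) div (2 * j + 1)\<^sup>2 + 1)"
    by (rule of_nat_mono)
  also have "\<dots> = (\<Sum>j=1..M. real ((8 * M) div (2 * j + 1)\<^sup>2)) + real M"
    by (simp add: sum.distrib)
  also have "(\<Sum>j=1..M. real ((8 * M) div (2 * j + 1)\<^sup>2))
      \<le> (\<Sum>j=1..M. real (8 * M) * (1 / real ((2 * j + 1)\<^sup>2)))"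
    by (intro sum_mono order.trans[OF of_nat_div_le_of_nat]) simp
  also have "\<dots> = real (8 * M) * (\<Sum>j=1..M. 1 / real ((2 * j + 1)\<^sup>2))"
    by (simp only: sum_distrib_left)
  also have "\<dots> \<le> real (8 * M) * (1/4)"
    by (intro mult_left_mono order.trans[OF sum_inverse_odd_squares_le]) auto
  finally show ?thesis by simp
qed

lemma infinite_squarefree_linear_pair:
  fixes a A b B :: int
  assumes a: "a > 0" "A > 0" "even A" "coprime a A"
    and b: "b > 0" "B > 0" "even B" "coprime b B"
  shows "infinite {n. squarefree (a + A * int n) \<and> squarefree (b + B * int n)}"
    (is "infinite ?G")
proof
  assume fin: "finite ?G"
  \<comment> \<open>Large enough for the sieve bound on both forms and for \<open>card ?G\<close>,
    so that \<open>8 * M\<close> would be at most \<open>7 * M\<close>.\<close>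
  define M where "M = nat (2 * A + a) + nat (2 * B + b) + card ?G"
  let ?X = "{n \<in> {..<8 * M}. \<not> squarefree (a + A * int n)}"
  let ?Y = "{n \<in> {..<8 * M}. \<not> squarefree (b + B * int n)}"
  have "8 * M = card {..<8 * M}" by simp
  also have "\<dots> \<le> card (?G \<union> (?X \<union> ?Y))"
    using fin by (intro card_mono) auto
  also have "\<dots> \<le> card ?G + (card ?X + card ?Y)"
    by (meson card_Un_le add_left_mono order.trans)
  also have "\<dots> \<le> card ?G + (3 * M + 3 * M)"
    using a b by (intro add_mono order_refl card_not_squarefree_linear_le) (auto simp: M_def)
  also have "card ?G \<le> M" by (simp add: M_def)
  finally have "M = 0" by simp
  with a show False by (simp add: M_def)
qed

text \<open>Odd squares are 1 mod 4 and \<open>2\<close>, \<open>- 2\<close> agree mod 4, so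
  \<open>d2\<close> is \<open>d1 + 2\<close> mod 4. Then \<open>d1 * d2\<close> is
  \<open>(d1 + 1)^2 - 1\<close> mod 4, with \<open>d1 + 1\<close> even.\<close>

lemma odd_square_combination_mod_4:
  fixes k l d1 d2 :: int
  assumes "odd k" "odd l" "odd d1" "odd d2"
    and "k\<^sup>2 * d2 - l\<^sup>2 * d1 = 2 \<or> k\<^sup>2 * d2 - l\<^sup>2 * d1 = - 2"
  shows "[d1 * d2 = 3] (mod 4)"
proof -
  have sq: "\<exists>i. x\<^sup>2 = 4 * i + 1" if "odd x" for x :: int
  proof -
    from that obtain c where "x = 2 * c + 1" by (elim oddE)
    then have "x\<^sup>2 = 4 * (c * c + c) + 1" by (simp add: power2_eq_square algebra_simps)
    then show ?thesis by blast
  qed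
  obtain i j c where ijc: "k\<^sup>2 = 4 * i + 1" "l\<^sup>2 = 4 * j + 1" "d1 = 2 * c + 1"
    using sq assms by (metis oddE)
  have "\<exists>e. d2 = d1 + 2 + 4 * e"
  proof -
    have "d2 = d1 + 2 + 4 * (j * d1 - i * d2) \<or> d2 = d1 + 2 + 4 * (j * d1 - i * d2 - 1)"
      using assms(5) unfolding ijc(1,2) by (auto simp: algebra_simps)
    then show ?thesis by blast
  qed
  then obtain e where "d2 = d1 + 2 + 4 * e" ..
  then have "d1 * d2 - 3 = 4 * (c * c + 2 * c + d1 * e)"
    by (simp add: ijc(3) algebra_simps)
  then show ?thesis
    by (simp add: cong_iff_dvd_diff)
qed

text \<open>A common divisor of \<open>x\<close> with \<open>y\<close> or with \<open>u\<close>
  divides \<open>u * y\<close>, hence also 2, while \<open>x\<close> is odd. The symmetric shape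
  allows use with the roles of \<open>d1\<close> and \<open>d2\<close> exchanged.\<close>

lemma coprime_of_odd_combination_eq_two:
  fixes x y u v :: int
  assumes "odd x" and "u * y - v * x = 2 \<or> u * y - v * x = - 2"
  shows "coprime x y" and "coprime x u"
proof -
  have "is_unit g" if "g dvd x" "g dvd u * y" for g
  proof -
    have "g dvd u * y - v * x" using that by simp
    then have "g dvd 2" using assms(2) by auto
    moreover have "coprime x 2" using assms(1) by simp
    ultimately show ?thesis using that(1) by (metis coprime_common_divisor)
  qed
  then show "coprime x y" "coprime x u" by (auto intro!: coprimeI)
qed

text \<open>The shift preserves the combination and the parities, and the sieve supplies squarefree
  values. Starting from any odd positive solution lets the lemma serve both the existence claim and
  the infinitude claim.\<close>

lemma infinite_admissible:
  fixes k l d1 d2 :: int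
  assumes "odd k" "odd l" "k\<^sup>2 < l\<^sup>2" "l\<^sup>2 < 3 * k\<^sup>2"
    and "d1 > 0" "d2 > 0" "odd d1" "odd d2"
    and eq: "k\<^sup>2 * d2 - l\<^sup>2 * d1 = 2 \<or> k\<^sup>2 * d2 - l\<^sup>2 * d1 = - 2"
  shows "infinite {n :: int. admissible (d1 + 2 * k\<^sup>2 * n) (d2 + 2 * l\<^sup>2 * n) k l}"
proof -
  have eq': "l\<^sup>2 * d1 - k\<^sup>2 * d2 = 2 \<or> l\<^sup>2 * d1 - k\<^sup>2 * d2 = - 2"
    using eq by linarith
  have pos: "k\<^sup>2 > 0" "l\<^sup>2 > 0" using assms by auto
  let ?G = "{n. squarefree (d1 + 2 * k\<^sup>2 * int n) \<and> squarefree (d2 + 2 * l\<^sup>2 * int n)}"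
  have "coprime d1 (2 * k\<^sup>2)" "coprime d2 (2 * l\<^sup>2)"
    using coprime_of_odd_combination_eq_two(2)[OF \<open>odd d1\<close> eq] coprime_of_odd_combination_eq_two(2)[OF \<open>odd d2\<close> eq']
      assms(7,8) by simp_all
  then have "infinite ?G"
    using assms pos by (intro infinite_squarefree_linear_pair) auto
  \<comment> \<open>Beyond \<open>d1 + d2\<close>, the growth in \<open>n\<close> outweighs the
    initial offsets in both ratio inequalities, because the integers
    \<open>l\<^sup>2 - k\<^sup>2\<close> and \<open>3 * k\<^sup>2 - l\<^sup>2\<close> are at least
    1.\<close>
  then have "infinite (?G - {..nat (d1 + d2)})" by simp
  then have "infinite (int ` (?G - {..nat (d1 + d2)}))"
    by (subst finite_image_iff) (auto simp: inj_on_def)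
  then show ?thesis
  proof (rule infinite_super[rotated], intro image_subsetI CollectI)
    fix n assume "n \<in> ?G - {..nat (d1 + d2)}"
    then have sf: "squarefree (d1 + 2 * k\<^sup>2 * int n)" "squarefree (d2 + 2 * l\<^sup>2 * int n)"
      and n: "int n > d1 + d2" by auto
    let ?x = "d1 + 2 * k\<^sup>2 * int n" and ?y = "d2 + 2 * l\<^sup>2 * int n"
    have eqn: "k\<^sup>2 * ?y - l\<^sup>2 * ?x = 2 \<or> k\<^sup>2 * ?y - l\<^sup>2 * ?x = - 2"
      using eq by (simp add: algebra_simps)
    have odd: "odd ?x" "odd ?y" using assms by auto
    have "1 * int n \<le> (l\<^sup>2 - k\<^sup>2) * int n"
      using assms by (intro mult_right_mono) auto
    then have "?x < ?y" using n assms by (simp add: algebra_simps)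
    moreover have "1 * int n \<le> (3 * k\<^sup>2 - l\<^sup>2) * int n"
      using assms by (intro mult_right_mono) auto
    then have "?y \<le> 3 * ?x" using n assms by (simp add: algebra_simps)
    moreover have "?x > 0" "?y > 0" using pos assms by (auto intro!: add_pos_nonneg)
    moreover have "squarefree (?x * ?y)"
      using sf coprime_of_odd_combination_eq_two(1)[OF odd(1) eqn] by (simp add: squarefree_mult_coprime)
    ultimately show "admissible ?x ?y k l"
      using eqn odd_square_combination_mod_4[OF \<open>odd k\<close> \<open>odd l\<close> odd eqn]
      by (simp add: admissible_def)
  qed
qed

text \<open>Doubling a Bezout identity for the squares gives the even solution
  \<open>(- 2 * y, 2 * x)\<close>. Adding a large odd multiple of
  \<open>(k\<^sup>2, l\<^sup>2)\<close> keeps the equation and makes both entries odd and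
  positive.\<close>

lemma exists_odd_pos_solution:
  fixes k l :: int
  assumes "odd k" "odd l" "coprime k l"
  obtains d1 d2 where "d1 > 0" "d2 > 0" "odd d1" "odd d2" "k\<^sup>2 * d2 - l\<^sup>2 * d1 = 2"
proof -
  have "coprime (k\<^sup>2) (l\<^sup>2)" using assms by simp
  then obtain x y where xy: "x * k\<^sup>2 + y * l\<^sup>2 = 1"
    by (metis bezout_int coprime_iff_gcd_eq_1)
  define t where "t = 2 * (\<bar>x\<bar> + \<bar>y\<bar>) + 1"
  have "k \<noteq> 0" "l \<noteq> 0" using assms by auto
  then have "1 \<le> k\<^sup>2" "1 \<le> l\<^sup>2" by (simp_all add: int_one_le_iff_zero_less)
  moreover have "0 \<le> t" by (simp add: t_def)
  ultimately have "t * 1 \<le> t * k\<^sup>2" "t * 1 \<le> t * l\<^sup>2"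
    by (auto intro!: mult_left_mono simp del: mult_1_right)
  moreover have "2 * y < t" "- 2 * x < t" by (auto simp: t_def)
  ultimately have "t * k\<^sup>2 - 2 * y > 0" "t * l\<^sup>2 + 2 * x > 0"
    by simp_all
  moreover have "odd (t * k\<^sup>2 - 2 * y)" "odd (t * l\<^sup>2 + 2 * x)"
    using assms by (auto simp: t_def)
  moreover have "k\<^sup>2 * (t * l\<^sup>2 + 2 * x) - l\<^sup>2 * (t * k\<^sup>2 - 2 * y) = 2 * (x * k\<^sup>2 + y * l\<^sup>2)"
    by (simp add: algebra_simps)
  ultimately show ?thesis
    unfolding xy mult_1_right by (intro that[of "t * k\<^sup>2 - 2 * y" "t * l\<^sup>2 + 2 * x"])
qed

theorem theorem5p5:
  fixes k l :: int
  assumes "odd k" and "odd l" and "gcd k l = 1"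
    and "k < l" and "real_of_int l < sqrt 3 * real_of_int k"
  shows "(\<exists>d1 d2. admissible d1 d2 k l) \<and>
    (\<forall>d1' d2'. admissible d1' d2' k l \<longrightarrow>
       infinite {n :: int. admissible (d1' + 2 * k^2 * n) (d2' + 2 * l^2 * n) k l})"
proof -
  \<comment> \<open>For \<open>k\<close> at most 0, \<open>sqrt 3 * k\<close> would be at most
    \<open>k\<close>, contradicting \<open>k < l < sqrt 3 * k\<close>. Positivity permits squaring
    the inequalities.\<close>
  have "k > 0"
  proof (rule ccontr)
    assume "\<not> k > 0"
    then have "sqrt 3 * real_of_int k \<le> 1 * real_of_int k"
      by (intro mult_right_mono_neg) auto
    with assms(4,5) show False by simp
  qed
  then have "(real_of_int l)\<^sup>2 < (sqrt 3 * real_of_int k)\<^sup>2"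
    using assms by (intro power_strict_mono) auto
  then have "real_of_int (l\<^sup>2) < real_of_int (3 * k\<^sup>2)"
    by (simp add: power_mult_distrib)
  then have lk: "l\<^sup>2 < 3 * k\<^sup>2" by linarith
  have kl: "k\<^sup>2 < l\<^sup>2"
    using assms(4) \<open>k > 0\<close> by (intro power_strict_mono) auto
  note inf = infinite_admissible[OF assms(1,2) kl lk]
  have "\<exists>d1 d2. admissible d1 d2 k l"
  proof -
    obtain d1 d2 where "d1 > 0" "d2 > 0" "odd d1" "odd d2" "k\<^sup>2 * d2 - l\<^sup>2 * d1 = 2"
      using exists_odd_pos_solution assms(1-3) by (metis coprime_iff_gcd_eq_1)
    then have "infinite {n. admissible (d1 + 2 * k\<^sup>2 * n) (d2 + 2 * l\<^sup>2 * n) k l}"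
      by (intro inf) auto
    \<comment> \<open>An infinite set of shifts is nonempty, and any member gives an admissible
      pair.\<close>
    then show ?thesis by (metis (mono_tags, lifting) Collect_empty_eq finite.emptyI)
  qed
  moreover have "infinite {n. admissible (d1 + 2 * k\<^sup>2 * n) (d2 + 2 * l\<^sup>2 * n) k l}"
    if adm: "admissible d1 d2 k l" for d1 d2
  proof -
    \<comment> \<open>The congruence enters only to make \<open>d1\<close> and \<open>d2\<close>
      odd.\<close>
    have "[d1 * d2 = 3] (mod 4)" using adm by (simp add: admissible_def)
    then have "[d1 * d2 = 3] (mod 2)" by (rule cong_dvd_modulus) simp
    then have "odd (d1 * d2)" by (metis cong_dvd_iff odd_numeral)
    with adm show ?thesis by (intro inf) (auto simp: admissible_def)
  qed
  ultimately show ?thesis by blast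
qed

end
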